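(* For any even integer $n\geq 6$, the $n$-cube $Q_n$ contains four pairwise edge-disjoint symmetric chain decompositions (SCDs).
   Context: The $n$-cube $Q_n$ is the graph whose vertices are all bitstrings of length $n$, with an edge between any two bitstrings that differ in exactly one bit. The $k$th level of $Q_n$ is the set of all bitstrings of length $n$ with exactly $k$ many 1-bits. A symmetric chain in $Q_n$ is a path $(x_k,x_{k+1},\ldots,x_{n-k})$ in $Q_n$ (for some $0\leq k\leq n/2$) where $x_i$ is from level $i$ for all $k\leq i\leq n-k$ (a single vertex is allowed when $k=n-k$). A symmetric chain decomposition (SCD) of $Q_n$ is a partition of the vertices of $Q_n$ into symmetric chains. Two SCDs are edge-disjoint if the corresponding sets of paths are edge-disjoint, i.e., there are no two vertices that are consecutive in a chain of the first SCD and also consecutive in a chain of the second SCD. *)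

theory Defs
  imports "HOL-Library.Disjoint_Sets" "Graph_Theory.Graph_Theory"
begin

(* An undirected graph is represented, as usual in Graph_Theory, by a symmetric
   loop-free digraph without parallel arcs (locale pair_graph). *)
definition cube :: "nat \<Rightarrow> bool list pair_pre_digraph" where
  "cube n = \<lparr> pverts = {u. length u = n},
              parcs = {(u, v). length u = n \<and> length v = n \<and>
                               card {i. i < n \<and> u ! i \<noteq> v ! i} = 1} \<rparr>"

definition level :: "nat \<Rightarrow> nat \<Rightarrow> bool list set" where
  "level n k = {u \<in> pverts (cube n). count_list u True = k}"

(* The list p is (x_k, ..., x_(n-k)), so p ! (i - k) is x_i.  Here n - 2 * k + 1 >= 1,
   so a list consisting of a single vertex qualifies exactly when 2 * k = n. *)
definition symmetric_chain :: "nat \<Rightarrow> bool list list \<Rightarrow> bool" where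
  "symmetric_chain n p \<longleftrightarrow>
     vpath p (with_proj (cube n)) \<and>
     (\<exists>k. 2 * k \<le> n \<and> length p = n - 2 * k + 1 \<and>
          (\<forall>i. k \<le> i \<and> i \<le> n - k \<longrightarrow> p ! (i - k) \<in> level n i))"

(* A symmetric chain lists its vertices by increasing level and is therefore determined
   by its vertex set; so no two chains of an SCD can share a vertex. *)
definition is_SCD :: "nat \<Rightarrow> bool list list set \<Rightarrow> bool" where
  "is_SCD n C \<longleftrightarrow>
     (\<forall>p\<in>C. symmetric_chain n p) \<and> partition_on (pverts (cube n)) (set ` C)"

definition path_edges :: "'a list \<Rightarrow> 'a set set" where
  "path_edges p = {{u, v} | u v. (u, v) \<in> set (vwalk_arcs p)}"

definition edge_disjoint :: "'a list set \<Rightarrow> 'a list set \<Rightarrow> bool" where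
  "edge_disjoint C D \<longleftrightarrow> (\<forall>p\<in>C. \<forall>q\<in>D. path_edges p \<inter> path_edges q = {})"

lemma pair_graph_cube: "pair_graph (cube n)"
proof -
  have fin: "finite (pverts (cube n))"
    using finite_lists_length_eq[of "UNIV :: bool set" n] by (simp add: cube_def)
  have sub: "parcs (cube n) \<subseteq> pverts (cube n) \<times> pverts (cube n)"
    by (auto simp: cube_def)
  have irrefl: "fst e \<noteq> snd e" if "e \<in> parcs (cube n)" for e
  proof
    assume "fst e = snd e"
    then have "card {i. i < n \<and> snd e ! i \<noteq> snd e ! i} = 1"
      using that by (simp add: cube_def split_beta)
    then show False
      by simp
  qed
  have "(v, u) \<in> parcs (cube n)" if "(u, v) \<in> parcs (cube n)" for u v
  proof -
    have *: "length u = n" "length v = n" "card {i. i < n \<and> u ! i \<noteq> v ! i} = 1"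
      using that by (simp_all add: cube_def)
    from *(3) have "card {i. i < n \<and> v ! i \<noteq> u ! i} = 1"
      by (rule back_subst[where P = "\<lambda>A. card A = 1"]) blast
    with *(1,2) show ?thesis
      by (simp add: cube_def)
  qed
  then have "sym (parcs (cube n))"
    by (rule symI)
  then have "symmetric (with_proj (cube n))"
    by (simp add: symmetric_def)
  moreover have "finite (parcs (cube n))"
    using sub fin finite_subset by blast
  ultimately show ?thesis
    using fin sub irrefl by unfold_locales auto
qed

end

theory Submission
  imports Defs "HOL-Library.Sublist"
begin

text \<open>
  Read 1 as an opening and 0 as a closing bracket. A bitstring is then a sequence of balanced
  words separated by the unmatched letters, and these are first zeros and then ones:
  \<open>A\<^sub>r 0 \<dots> A\<^sub>1 0 M 1 B\<^sub>1 \<dots> 1 B\<^sub>s\<close>. A balanced word is a plane forest, so bitstrings are in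
  bijection with triples (unmatched zeros, middle forest, unmatched ones), which behave like a
  list with a cursor at \<open>M\<close>.

  Two ways of raising a bit are bijections between easily described sets of triples. The map
  \<open>up0\<close> turns the last unmatched 0 into a 1, so that the cursor moves one step to the left; this
  is the classical decomposition of Greene and Kleitman. The map \<open>up1\<close> alternates two moves: when
  \<open>M = 1 E 0 F\<close> it raises the closing bracket of the first arch, which dissolves the
  arch into two unmatched ones; when \<open>M\<close> is empty it raises the second-to-last unmatched 0, which
  becomes the opening bracket of an arch closed by the last one. Two moves together keep
  the number of arches and turn two unmatched zeros into two unmatched ones. Since \<open>r + s\<close> is even,
  a chain starts with \<open>s = c\<close> and ends with \<open>r = c\<close> for the same \<open>c \<in> {0, 1}\<close>,
  and therefore is symmetric. The reversals of all words in a chain form a symmetric chain too,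
  so that four decompositions result.

  Their edges are separated by a counting argument. Write an edge as \<open>u 0 v \<midarrow> u 1 v\<close> and let
  its defect be the number of suffixes of \<open>u\<close> with more ones than zeros plus the number of
  prefixes of \<open>v\<close> with more zeros than ones. The edges of \<open>up0\<close> have defect 0 and those of \<open>up1\<close>
  have defect at most 1. Reversal exchanges \<open>u\<close> and \<open>v\<close>, so it replaces the condition on each
  piece by the opposite strict inequality, and a piece of odd length satisfies one of the two. Hence the
  defects of an edge and of its reversal add up to at least the number \<open>n div 2\<close> of odd pieces
  (\<open>defect_plus_defect_rev\<close>). For \<open>n \<ge> 6\<close> this is at least 3, so no edge of the first two
  decompositions is an edge of the reversed ones. Finally \<open>up0\<close> and \<open>up1\<close> never take the same
  triple to the same triple.
\<close>

section \<open>Symmetric chains from an injective raising map\<close>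

abbreviation ones :: "bool list \<Rightarrow> nat" where
  "ones w \<equiv> count_list w True"

definition raises :: "bool list \<Rightarrow> bool list \<Rightarrow> bool" where
  "raises x y \<longleftrightarrow> (\<exists>u v. x = u @ False # v \<and> y = u @ True # v)"

lemma raises_length: "raises x y \<Longrightarrow> length y = length x"
  by (auto simp: raises_def)

lemma raises_ones: "raises x y \<Longrightarrow> ones y = Suc (ones x)"
  by (auto simp: raises_def)

lemma raises_rev:
  assumes "raises x y"
  shows "raises (rev x) (rev y)"
proof -
  from assms obtain u v where "x = u @ False # v" "y = u @ True # v"
    by (auto simp: raises_def)
  then have "rev x = rev v @ False # rev u" "rev y = rev v @ True # rev u"
    by simp_all
  then show ?thesis
    by (auto simp: raises_def)
qed

lemma raises_arc:
  assumes "raises x y" and "length x = n"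
  shows "(x, y) \<in> parcs (cube n)"
proof -
  from assms obtain u v where x: "x = u @ False # v" and y: "y = u @ True # v"
    by (auto simp: raises_def)
  have "{i. i < n \<and> x ! i \<noteq> y ! i} = {length u}"
    using assms(2) by (auto simp: x y nth_append nth_Cons')
  then show ?thesis
    using assms(2) by (simp add: cube_def x y)
qed

lemma set_vwalk_arcs_map_upt:
  "set (vwalk_arcs (map g [0..<Suc m])) = (\<lambda>i. (g i, g (Suc i))) ` {..<m}"
proof (induction m)
  case (Suc m)
  have "map g [0..<Suc (Suc m)] = map g [0..<Suc m] @ [g (Suc m)]"
    by simp
  moreover have "map g [0..<Suc m] \<noteq> []" and "last (map g [0..<Suc m]) = g m"
    by simp_all
  ultimately have "set (vwalk_arcs (map g [0..<Suc (Suc m)]))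
      = insert (g m, g (Suc m)) (set (vwalk_arcs (map g [0..<Suc m])))"
    by (metis set_vwalk_arcs_snoc)
  then show ?case
    by (simp only: Suc.IH) (simp add: lessThan_Suc)
qed simp

text \<open>
  The number \<open>base s\<close> is the level at which the chain through \<open>s\<close> should begin; being constant
  along \<open>up\<close>, it forces the chain to end on level \<open>n - base s\<close> as soon as \<open>up\<close> is undefined only
  there. Symmetry thus becomes a condition on single vertices. The map \<open>up\<close> acts on
  encodings of words, so that another encoding of the same words yields another decomposition.
\<close>

locale chain_map =
  fixes n :: nat
    and spell :: "'s \<Rightarrow> bool list"
    and up :: "'s \<Rightarrow> 's option"
    and base :: "'s \<Rightarrow> nat"
  assumes bij_spell: "bij spell"
    and raises_up: "up s = Some t \<Longrightarrow> raises (spell s) (spell t)"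
    and up_inj: "up s = Some t \<Longrightarrow> up s' = Some t \<Longrightarrow> s = s'"
    and base_up: "up s = Some t \<Longrightarrow> base t = base s"
    and base_le: "length (spell s) = n \<Longrightarrow> base s \<le> ones (spell s)"
    and le_top: "length (spell s) = n \<Longrightarrow> ones (spell s) + base s \<le> n"
    and at_top: "length (spell s) = n \<Longrightarrow> up s = None \<Longrightarrow> ones (spell s) + base s = n"
    and at_base: "length (spell s) = n \<Longrightarrow> (\<And>r. up r \<noteq> Some s) \<Longrightarrow> ones (spell s) = base s"
begin

definition climb :: "nat \<Rightarrow> 's \<Rightarrow> 's" where
  "climb i = (the \<circ> up) ^^ i"

definition bottoms :: "'s set" where
  "bottoms = {s. length (spell s) = n \<and> ones (spell s) = base s}"

definition chain :: "'s \<Rightarrow> bool list list" where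
  "chain s = map (\<lambda>i. spell (climb i s)) [0..<Suc (n - 2 * base s)]"

lemma climb_Suc: "climb (Suc i) s = the (up (climb i s))"
  by (simp add: climb_def)

lemma climb_bottom:
  assumes "s \<in> bottoms" and "i \<le> n - 2 * base s"
  shows "length (spell (climb i s)) = n \<and> base (climb i s) = base s \<and>
         ones (spell (climb i s)) = base s + i"
  using assms(2)
proof (induction i)
  case 0
  then show ?case
    using assms(1) by (simp add: climb_def bottoms_def)
next
  case (Suc i)
  then have IH: "length (spell (climb i s)) = n" "base (climb i s) = base s"
      "ones (spell (climb i s)) = base s + i"
    by simp_all
  have "up (climb i s) \<noteq> None"
  proof
    assume "up (climb i s) = None"
    then show False
      using at_top[OF IH(1)] IH Suc.prems by simp
  qed
  then have up: "up (climb i s) = Some (climb (Suc i) s)"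
    by (auto simp: climb_Suc)
  show ?case
    using raises_length[OF raises_up[OF up]] raises_ones[OF raises_up[OF up]] base_up[OF up] IH
    by simp
qed

lemma climb_up:
  assumes "s \<in> bottoms" and "i < n - 2 * base s"
  shows "up (climb i s) = Some (climb (Suc i) s)"
proof -
  have "up (climb i s) \<noteq> None"
  proof
    assume "up (climb i s) = None"
    then show False
      using at_top[of "climb i s"] climb_bottom[OF assms(1), of i] assms(2) by simp
  qed
  then show ?thesis
    by (auto simp: climb_Suc)
qed

text \<open>
  Descending from \<open>t\<close> along \<open>up\<close> lowers the level, and can stop only at a bottom.
\<close>

lemma reached_from_bottom:
  assumes "length (spell t) = n"
  shows "\<exists>s i. s \<in> bottoms \<and> i \<le> n - 2 * base s \<and> t = climb i s"
  using assms
proof (induction "ones (spell t)" arbitrary: t rule: less_induct)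
  case less
  show ?case
  proof (cases "\<exists>r. up r = Some t")
    case True
    then obtain r where r: "up r = Some t" ..
    note raise = raises_up[OF r]
    have len: "length (spell r) = n"
      using raises_length[OF raise] less.prems by simp
    have "ones (spell r) < ones (spell t)"
      using raises_ones[OF raise] by simp
    with less.hyps len obtain s i where
      s: "s \<in> bottoms" "i \<le> n - 2 * base s" "r = climb i s"
      by blast
    have t: "t = climb (Suc i) s"
      using r s(3) by (simp add: climb_Suc)
    have "ones (spell t) + base t \<le> n"
      using le_top less.prems by blast
    then have "Suc i \<le> n - 2 * base s"
      using base_up[OF r] raises_ones[OF raise] climb_bottom[OF s(1,2)] s(3) by simp
    then show ?thesis
      using s(1) t by blast
  next
    case False
    then have "t \<in> bottoms"
      using at_base less.prems by (auto simp: bottoms_def)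
    moreover have "t = climb 0 t"
      by (simp add: climb_def)
    ultimately show ?thesis
      by blast
  qed
qed

text \<open>
  Equal bases and equal levels give \<open>i = j\<close>; then injectivity of \<open>up\<close> cancels the steps one by one.
\<close>

lemma climb_inj:
  assumes s: "s \<in> bottoms" and s': "s' \<in> bottoms"
    and "i \<le> n - 2 * base s" and "j \<le> n - 2 * base s'"
    and "climb i s = climb j s'"
  shows "s = s' \<and> i = j"
proof -
  have "base s = base s'" "i = j"
    using climb_bottom[OF s assms(3)] climb_bottom[OF s' assms(4)] assms(5) by auto
  have "climb i s = climb i s' \<Longrightarrow> i \<le> n - 2 * base s \<Longrightarrow> s = s'" for i
  proof (induction i)
    case (Suc i)
    have "up (climb i s) = Some (climb (Suc i) s)" "up (climb i s') = Some (climb (Suc i) s')"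
      using climb_up[OF s] climb_up[OF s'] Suc.prems(2) \<open>base s = base s'\<close> by auto
    then have "climb i s = climb i s'"
      using up_inj Suc.prems(1) by metis
    then show ?case
      using Suc by simp
  qed (simp add: climb_def)
  with assms(3,5) \<open>i = j\<close> show ?thesis
    by blast
qed

lemma spell_eq_iff: "spell s = spell t \<longleftrightarrow> s = t"
  using bij_spell by (simp add: bij_def inj_eq)

lemma set_vwalk_arcs_chain:
  "set (vwalk_arcs (chain s)) = (\<lambda>i. (spell (climb i s), spell (climb (Suc i) s))) ` {..<n - 2 * base s}"
  unfolding chain_def by (rule set_vwalk_arcs_map_upt)

lemma symmetric_chain_chain:
  assumes s: "s \<in> bottoms"
  shows "symmetric_chain n (chain s)"
proof -
  note b = climb_bottom[OF s]
  have "2 * base s \<le> n"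
    using le_top[of s] s by (simp add: bottoms_def)
  have "set (vwalk_arcs (chain s)) \<subseteq> parcs (cube n)"
    using raises_arc[OF raises_up[OF climb_up[OF s]]] b by (auto simp: set_vwalk_arcs_chain)
  moreover have "set (chain s) \<subseteq> pverts (cube n)"
    using b by (auto simp: chain_def cube_def)
  moreover have "distinct (chain s)"
    using climb_inj[OF s s]
    by (auto simp: chain_def distinct_map inj_on_def spell_eq_iff less_Suc_eq_le simp del: upt_Suc)
  moreover have "chain s \<noteq> []"
    by (simp add: chain_def)
  ultimately have "vpath (chain s) (with_proj (cube n))"
    by (simp add: vpath_def vwalk_def)
  moreover have "chain s ! (i - base s) \<in> level n i" if "base s \<le> i" "i \<le> n - base s" for i
  proof -
    have le: "i - base s \<le> n - 2 * base s"
      using that by simp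
    then have "chain s ! (i - base s) = spell (climb (i - base s) s)"
      by (simp add: chain_def less_Suc_eq_le del: upt_Suc)
    then show ?thesis
      using b[OF le] that(1) by (simp add: level_def cube_def)
  qed
  ultimately show ?thesis
    unfolding symmetric_chain_def using \<open>2 * base s \<le> n\<close>
    by (intro conjI exI[of _ "base s"]) (simp_all add: chain_def)
qed

lemma set_chain: "set (chain s) = (\<lambda>i. spell (climb i s)) ` {..n - 2 * base s}"
  by (auto simp: chain_def less_Suc_eq_le simp del: upt_Suc)

lemma is_SCD_chains: "is_SCD n (chain ` bottoms)"
proof -
  have "\<Union> (set ` chain ` bottoms) = pverts (cube n)"
  proof
    show "\<Union> (set ` chain ` bottoms) \<subseteq> pverts (cube n)"
      using climb_bottom by (auto simp: set_chain cube_def)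
    show "pverts (cube n) \<subseteq> \<Union> (set ` chain ` bottoms)"
    proof
      fix w assume w: "w \<in> pverts (cube n)"
      obtain t where t: "w = spell t"
        using bij_spell by (metis bij_pointE)
      then obtain s i where "s \<in> bottoms" "i \<le> n - 2 * base s" "t = climb i s"
        using reached_from_bottom[of t] w by (auto simp: cube_def)
      then show "w \<in> \<Union> (set ` chain ` bottoms)"
        using t by (auto simp: set_chain)
    qed
  qed
  moreover have "disjoint (set ` chain ` bottoms)"
  proof (rule disjointI)
    fix A B assume "A \<in> set ` chain ` bottoms" "B \<in> set ` chain ` bottoms" "A \<noteq> B"
    then obtain s s' where s: "s \<in> bottoms" "A = set (chain s)"
      and s': "s' \<in> bottoms" "B = set (chain s')" and "s \<noteq> s'"
      by blast
    show "A \<inter> B = {}"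
    proof (rule ccontr)
      assume "A \<inter> B \<noteq> {}"
      then obtain i j where "i \<le> n - 2 * base s" "j \<le> n - 2 * base s'" "climb i s = climb j s'"
        by (auto simp: s s' set_chain spell_eq_iff)
      then show False
        using climb_inj[OF s(1) s'(1)] \<open>s \<noteq> s'\<close> by blast
    qed
  qed
  moreover have "{} \<notin> set ` chain ` bottoms"
    by (auto simp: chain_def)
  ultimately show ?thesis
    unfolding is_SCD_def partition_on_def using symmetric_chain_chain by blast
qed

lemma path_edges_chain:
  assumes "s \<in> bottoms" and "e \<in> path_edges (chain s)"
  shows "\<exists>t t'. up t = Some t' \<and> length (spell t) = n \<and> e = {spell t, spell t'}"
proof -
  obtain i where i: "i < n - 2 * base s" "e = {spell (climb i s), spell (climb (Suc i) s)}"
    using assms(2) by (auto simp: path_edges_def set_vwalk_arcs_chain)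
  then show ?thesis
    using climb_up[OF assms(1)] climb_bottom[OF assms(1), of i] by auto
qed

end

lemma chain_map_rev:
  assumes "chain_map n spell up base"
  shows "chain_map n (rev \<circ> spell) up base"
proof -
  interpret chain_map n spell up base by fact
  have "bij (rev :: bool list \<Rightarrow> bool list)"
    by (rule involuntory_imp_bij) simp
  then have "bij (rev \<circ> spell)"
    using bij_spell by (rule bij_comp[rotated])
  then show ?thesis
    using raises_rev[OF raises_up] up_inj base_up base_le le_top at_top at_base
    by (intro chain_map.intro) simp_all
qed

section \<open>Words as zippers of plane forests\<close>

datatype tree = Node "tree list"

fun dyck :: "tree list \<Rightarrow> bool list" where
  "dyck [] = []"
| "dyck (Node E # F) = True # dyck E @ False # dyck F"

type_synonym zipper = "tree list list \<times> tree list \<times> tree list list"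

primrec descent :: "tree list list \<Rightarrow> bool list" where
  "descent [] = []"
| "descent (A # L) = descent L @ dyck A @ [False]"

primrec ascent :: "tree list list \<Rightarrow> bool list" where
  "ascent [] = []"
| "ascent (B # R) = True # dyck B @ ascent R"

text \<open>
  Both outer lists of a zipper begin with the forest that is nearest to the middle one.
\<close>

fun spell :: "zipper \<Rightarrow> bool list" where
  "spell (L, M, R) = descent L @ dyck M @ ascent R"

lemma dyck_append [simp]: "dyck (F @ G) = dyck F @ dyck G"
  by (induction F rule: dyck.induct) simp_all

lemma ascent_append [simp]: "ascent (R @ S) = ascent R @ ascent S"
  by (induction R) simp_all

text \<open>
  While a word is read from left to right, the ascent is kept in reverse, so that its head is the
  rightmost forest, the one that still grows.
\<close>

fun attach :: "tree list \<Rightarrow> zipper \<Rightarrow> zipper" where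
  "attach F (L, M, []) = (L, M @ F, [])"
| "attach F (L, M, B # R) = (L, M, (B @ F) # R)"

fun read :: "zipper \<Rightarrow> bool \<Rightarrow> zipper" where
  "read (L, M, R) True = (L, M, [] # R)"
| "read (L, M, []) False = (M # L, [], [])"
| "read (L, M, B # R) False = attach [Node B] (L, M, R)"

definition parse :: "bool list \<Rightarrow> zipper" where
  "parse w = map_prod id (map_prod id rev) (foldl read ([], [], []) w)"

lemma attach_attach: "attach G (attach F z) = attach (F @ G) z"
  by (cases "(F, z)" rule: attach.cases) simp_all

lemma attach_Nil [simp]: "attach [] z = z"
  by (cases "([] :: tree list, z)" rule: attach.cases) simp_all

text \<open>
  A balanced word leaves no bracket open: it only enlarges the forest that was rightmost
  before.
\<close>

lemma foldl_read_dyck: "foldl read z (dyck F) = attach F z"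
proof (induction F arbitrary: z rule: dyck.induct)
  case (2 E F)
  obtain L M R where z: "z = (L, M, R)"
    by (cases z)
  have "foldl read z (dyck (Node E # F)) = attach F (attach [Node E] z)"
    by (simp add: 2 z)
  then show ?case
    by (simp add: attach_attach)
qed simp

lemma foldl_read_descent: "foldl read ([], [], []) (descent L) = (L, [], [])"
  by (induction L) (simp_all add: foldl_read_dyck)

lemma foldl_read_ascent: "foldl read (L, M, S) (ascent R) = (L, M, rev R @ S)"
  by (induction R arbitrary: S) (simp_all add: foldl_read_dyck)

lemma parse_spell: "parse (spell z) = z"
  by (cases z) (simp add: parse_def foldl_read_descent foldl_read_dyck foldl_read_ascent)

lemma spell_attach:
  "spell (map_prod id (map_prod id rev) (attach F z))
   = spell (map_prod id (map_prod id rev) z) @ dyck F"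
  by (cases "(F, z)" rule: attach.cases) simp_all

lemma spell_read:
  "spell (map_prod id (map_prod id rev) (read z b))
   = spell (map_prod id (map_prod id rev) z) @ [b]"
  by (cases "(z, b)" rule: read.cases) (simp_all add: spell_attach)

lemma spell_parse: "spell (parse w) = w"
  by (induction w rule: rev_induct) (simp_all add: parse_def spell_read)

lemma bij_spell: "bij spell"
  by (rule bijI') (metis parse_spell, metis spell_parse)

section \<open>The two chain maps\<close>

fun size_forest :: "tree list \<Rightarrow> nat" where
  "size_forest [] = 0"
| "size_forest (Node E # F) = Suc (size_forest E + size_forest F)"

fun arches :: "zipper \<Rightarrow> nat" where
  "arches (L, M, R) = sum_list (map size_forest L) + size_forest M + sum_list (map size_forest R)"

lemma size_forest_append [simp]: "size_forest (F @ G) = size_forest F + size_forest G"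
  by (induction F rule: size_forest.induct) simp_all

lemma ones_dyck [simp]: "ones (dyck F) = size_forest F"
  by (induction F rule: dyck.induct) simp_all

lemma length_dyck [simp]: "length (dyck F) = 2 * size_forest F"
  by (induction F rule: dyck.induct) simp_all

lemma ones_spell: "ones (spell (L, M, R)) = arches (L, M, R) + length R"
proof -
  have "ones (descent L) = sum_list (map size_forest L)"
    by (induction L) simp_all
  moreover have "ones (ascent R) = sum_list (map size_forest R) + length R"
    by (induction R) simp_all
  ultimately show ?thesis
    by simp
qed

lemma length_spell: "length (spell (L, M, R)) = 2 * arches (L, M, R) + length L + length R"
proof -
  have "length (descent L) = 2 * sum_list (map size_forest L) + length L"
    by (induction L) simp_all
  moreover have "length (ascent R) = 2 * sum_list (map size_forest R) + length R"
    by (induction R) simp_all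
  ultimately show ?thesis
    by simp
qed

fun up0 :: "zipper \<Rightarrow> zipper option" where
  "up0 ([], M, R) = None"
| "up0 (A # L, M, R) = Some (L, A, M # R)"

text \<open>
  In the first clause the arch \<open>1 E 0\<close> followed by \<open>F\<close> becomes \<open>1 E 1 F\<close>. In the second one
  \<open>A' 0 A 0\<close> becomes the forest \<open>A' 1 A 0\<close>; it is nonempty, so the next step uses the first
  clause, whose result has an empty middle again.
\<close>

fun up1 :: "zipper \<Rightarrow> zipper option" where
  "up1 (L, Node E # F, R) = Some (L, [], E # F # R)"
| "up1 (A # A' # L, [], R) = Some (L, A' @ [Node A], R)"
| "up1 ([A], [], R) = None"
| "up1 ([], [], R) = None"

text \<open>
  The first clause of \<open>up1\<close> removes an arch and empties the middle forest, the second one creates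
  an arch in the empty middle, so the difference below does not change; nor does the parity of
  \<open>length R\<close>. At the bottom of a chain the middle is empty and at most one 1 is unmatched, and
  there the sum is the number of ones.
\<close>

fun base1 :: "zipper \<Rightarrow> nat" where
  "base1 (L, M, R) = arches (L, M, R) - of_bool (M \<noteq> []) + length R mod 2"

lemma forest_cases [case_names Nil Cons]:
  obtains "M = []" | E F where "M = Node E # F"
  by (metis list.exhaust tree.exhaust)

lemma forest_rev_cases [case_names Nil snoc]:
  obtains "M = []" | A A' where "M = A' @ [Node A]"
  by (metis rev_exhaust tree.exhaust)

lemma chain_map_up0: "chain_map n spell up0 arches"
proof
  show "bij spell"
    by (rule bij_spell)
next
  fix s t assume "up0 s = Some t"
  then obtain A L M R where st: "s = (A # L, M, R)" "t = (L, A, M # R)"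
    by (cases s rule: up0.cases) auto
  have "spell s = (descent L @ dyck A) @ False # (dyck M @ ascent R)"
    "spell t = (descent L @ dyck A) @ True # (dyck M @ ascent R)"
    by (simp_all add: st)
  then show "raises (spell s) (spell t)"
    unfolding raises_def by blast
  show "arches t = arches s"
    by (simp add: st)
next
  fix s s' t assume "up0 s = Some t" "up0 s' = Some t"
  then show "s = s'"
    by (cases s rule: up0.cases; cases s' rule: up0.cases) auto
next
  fix s assume len: "length (spell s) = n"
  obtain L M R where s: "s = (L, M, R)"
    by (cases s)
  note [simp] = ones_spell length_spell
  show "arches s \<le> ones (spell s)" "ones (spell s) + arches s \<le> n"
    using len by (simp_all add: s del: spell.simps arches.simps)
  show "ones (spell s) + arches s = n" if "up0 s = None"
    using len that by (cases L) (simp_all add: s del: spell.simps arches.simps)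
  show "ones (spell s) = arches s" if "\<And>r. up0 r \<noteq> Some s"
  proof (cases R)
    case (Cons B R')
    then show ?thesis
      using that[of "(M # L, B, R')"] by (simp add: s)
  qed (simp add: s del: spell.simps arches.simps)
qed

lemma raises_spell_up1:
  assumes "up1 s = Some t"
  shows "raises (spell s) (spell t)"
  using assms
proof (cases s rule: up1.cases)
  case (1 L E F R)
  then have "spell s = (descent L @ True # dyck E) @ False # (dyck F @ ascent R)"
    "spell t = (descent L @ True # dyck E) @ True # (dyck F @ ascent R)"
    using assms by auto
  then show ?thesis
    unfolding raises_def by blast
next
  case (2 A A' L R)
  then have "spell s = (descent L @ dyck A') @ False # (dyck A @ False # ascent R)"
    "spell t = (descent L @ dyck A') @ True # (dyck A @ False # ascent R)"
    using assms by auto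
  then show ?thesis
    unfolding raises_def by blast
qed simp_all

text \<open>
  Evenness of \<open>n\<close> says that the numbers of unmatched zeros and of unmatched ones have the same
  parity. The former is at most 1 where \<open>up1\<close> stops, hence equal to the parity bit that \<open>base1\<close>
  counts.
\<close>

lemma chain_map_up1:
  assumes "even n"
  shows "chain_map n spell up1 base1"
proof
  show "bij spell"
    by (rule bij_spell)
  show "raises (spell s) (spell t)" if "up1 s = Some t" for s t
    using that by (rule raises_spell_up1)
next
  fix s t assume "up1 s = Some t"
  then show "base1 t = base1 s"
    by (cases s rule: up1.cases) auto
next
  fix s s' t assume "up1 s = Some t" "up1 s' = Some t"
  then show "s = s'"
    by (cases s rule: up1.cases; cases s' rule: up1.cases) auto
next
  fix s assume len: "length (spell s) = n"
  obtain L M R where s: "s = (L, M, R)"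
    by (cases s)
  have len': "2 * arches s + length L + length R = n"
    using len by (simp only: s length_spell)
  have ones: "ones (spell s) = arches s + length R"
    by (simp only: s ones_spell)
  have base: "base1 s = arches s - of_bool (M \<noteq> []) + length R mod 2"
    by (simp add: s)
  have parity: "length L mod 2 = length R mod 2"
    using len' assms by presburger
  show "base1 s \<le> ones (spell s)"
    unfolding ones base by (intro add_mono) simp_all
  have "length R mod 2 \<le> length L"
    using parity mod_less_eq_dividend by metis
  then show "ones (spell s) + base1 s \<le> n"
    using len' unfolding ones base by linarith
  show "ones (spell s) + base1 s = n" if "up1 s = None"
  proof -
    have "M = []" "length L \<le> 1"
      using that unfolding s by (cases "(L, M, R)" rule: up1.cases; simp)+
    then have "length L = length R mod 2"
      using parity by simp
    then show ?thesis
      using len' \<open>M = []\<close> unfolding ones base by simp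
  qed
  show "ones (spell s) = base1 s" if not_up: "\<And>r. up1 r \<noteq> Some s"
  proof -
    have "M = []"
    proof (cases M rule: forest_rev_cases)
      case (snoc A A')
      then show ?thesis
        using not_up[of "(A # A' # L, [], R)"] by (simp add: s)
    qed
    moreover have "length R \<le> 1"
    proof (rule ccontr)
      assume "\<not> length R \<le> 1"
      then obtain E F R' where "R = E # F # R'"
        by (cases R rule: remdups_adj.cases) auto
      then show False
        using not_up[of "(L, Node E # F, R')"] \<open>M = []\<close> by (simp add: s)
    qed
    ultimately show ?thesis
      unfolding ones base by simp
  qed
qed

section \<open>The defect of an edge\<close>

definition balance :: "bool list \<Rightarrow> int" where
  "balance w = int (ones w) - int (count_list w False)"

lemma balance_simps [simp]:
  "balance [] = 0"
  "balance (True # w) = balance w + 1"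
  "balance (False # w) = balance w - 1"
  "balance (v @ w) = balance v + balance w"
  "balance (rev w) = balance w"
  by (simp_all add: balance_def)

lemma even_balance_iff: "even (balance w) \<longleftrightarrow> even (length w)"
proof (induction w)
  case (Cons b w)
  then show ?case
    by (cases b) simp_all
qed simp

text \<open>
  The defect of \<open>u 0 v \<midarrow> u 1 v\<close> vanishes if and only if \<open>u\<close> has no unmatched 1 and \<open>v\<close> no
  unmatched 0, that is, if the raised bit is the last unmatched 0. It measures how far an edge is
  from being one of Greene and Kleitman.
\<close>

definition defect :: "bool list \<Rightarrow> bool list \<Rightarrow> nat" where
  "defect u v = card {s. suffix s u \<and> balance s > 0} + card {p. prefix p v \<and> balance p < 0}"

lemma finite_prefix_Collect [simp]: "finite {p. prefix p v \<and> P p}"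
proof (rule finite_subset)
  show "{p. prefix p v \<and> P p} \<subseteq> set (prefixes v)"
    by auto
qed simp

lemma card_prefix_rev:
  assumes "\<And>w. P (rev w) = P w"
  shows "card {p. prefix p (rev w) \<and> P p} = card {s. suffix s w \<and> P s}"
proof -
  have "{p. prefix p (rev w) \<and> P p} = rev ` {s. suffix s w \<and> P s}"
  proof (intro equalityI subsetI)
    fix p assume "p \<in> {p. prefix p (rev w) \<and> P p}"
    then have "p = rev (rev p)" "rev p \<in> {s. suffix s w \<and> P s}"
      using assms by (simp_all add: suffix_to_prefix)
    then show "p \<in> rev ` {s. suffix s w \<and> P s}"
      by (rule image_eqI)
  qed (use assms in \<open>auto simp: suffix_to_prefix\<close>)
  then show ?thesis
    by (simp add: card_image)
qed

text \<open>
  A prefix of odd length has odd balance, which is therefore not zero.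
\<close>

lemma nonzero_prefixes:
  "(length v + 1) div 2 \<le> card {p. prefix p v \<and> balance p > 0} + card {p. prefix p v \<and> balance p < 0}"
proof -
  have "(length v + 1) div 2 = card ((\<lambda>k. take (2 * k + 1) v) ` {..<(length v + 1) div 2})"
  proof -
    have "inj_on (\<lambda>k. take (2 * k + 1) v) {..<(length v + 1) div 2}"
    proof (rule inj_onI)
      fix i j assume "i \<in> {..<(length v + 1) div 2}" "j \<in> {..<(length v + 1) div 2}"
        and eq: "take (2 * i + 1) v = take (2 * j + 1) v"
      then have "2 * i + 1 \<le> length v" "2 * j + 1 \<le> length v"
        by auto
      then show "i = j"
        using arg_cong[OF eq, of length] by simp
    qed
    then show ?thesis
      by (simp add: card_image)
  qed
  also have "\<dots> \<le> card ({p. prefix p v \<and> balance p > 0} \<union> {p. prefix p v \<and> balance p < 0})"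
  proof (intro card_mono finite_UnI finite_prefix_Collect image_subsetI)
    fix k assume "k \<in> {..<(length v + 1) div 2}"
    then have "odd (length (take (2 * k + 1) v))"
      by (simp add: min_def) presburger
    then have "balance (take (2 * k + 1) v) \<noteq> 0"
      using even_balance_iff[of "take (2 * k + 1) v"] by auto
    then show "take (2 * k + 1) v
        \<in> {p. prefix p v \<and> balance p > 0} \<union> {p. prefix p v \<and> balance p < 0}"
      using take_is_prefix by fastforce
  qed
  also have "\<dots> \<le> card {p. prefix p v \<and> balance p > 0} + card {p. prefix p v \<and> balance p < 0}"
    by (rule card_Un_le)
  finally show ?thesis .
qed

text \<open>
  Prefixes of \<open>rev u\<close> are reversed suffixes of \<open>u\<close>, with the same balance. Thus the two defects
  together count every suffix of \<open>u\<close> and every prefix of \<open>v\<close> with nonzero balance once.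
\<close>

lemma defect_plus_defect_rev:
  "(length u + 1) div 2 + (length v + 1) div 2 \<le> defect u v + defect (rev v) (rev u)"
proof -
  have "card {s. suffix s (rev v) \<and> balance s > 0} = card {p. prefix p v \<and> balance p > 0}"
    using card_prefix_rev[of "\<lambda>s. balance s > 0" "rev v"] by simp
  moreover have "card {p. prefix p (rev u) \<and> balance p > 0} = card {s. suffix s u \<and> balance s > 0}"
    by (rule card_prefix_rev) simp
  ultimately show ?thesis
    using nonzero_prefixes[of v] nonzero_prefixes[of "rev u"] by (simp add: defect_def)
qed

definition low_defect :: "bool list \<Rightarrow> bool list \<Rightarrow> bool" where
  "low_defect x y \<longleftrightarrow>
     (\<exists>u v. x = u @ False # v \<and> y = u @ True # v \<and> defect u v \<le> 1)"

lemma raised_position_unique: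
  assumes "u @ False # v = u' @ False # v'" and "u @ True # v = u' @ True # v'"
  shows "u = u' \<and> v = v'"
proof -
  have "length u = length u'"
  proof (rule ccontr)
    assume "length u \<noteq> length u'"
    then consider "length u < length u'" | "length u' < length u"
      by linarith
    then show False
    proof cases
      case 1
      then show False
        using arg_cong[OF assms(1), of "\<lambda>w. w ! length u"]
          arg_cong[OF assms(2), of "\<lambda>w. w ! length u"] by (simp add: nth_append)
    next
      case 2
      then show False
        using arg_cong[OF assms(1), of "\<lambda>w. w ! length u'"]
          arg_cong[OF assms(2), of "\<lambda>w. w ! length u'"] by (simp add: nth_append)
    qed
  qed
  then show ?thesis
    using assms(1) by simp
qed

text \<open>
  Since the lengths of \<open>u\<close> and \<open>v\<close> add up to the odd number \<open>n - 1\<close>, the bound on the sum of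
  the defects equals \<open>n div 2 \<ge> 3\<close>, whereas the sum of two defects here is at most 2.
\<close>

lemma no_low_defect_rev:
  assumes "low_defect x y" and "even (length x)" and "length x \<ge> 6"
  shows "\<not> low_defect (rev x) (rev y)"
proof
  assume "low_defect (rev x) (rev y)"
  then obtain u' v' where rev: "rev x = u' @ False # v'" "rev y = u' @ True # v'" "defect u' v' \<le> 1"
    by (auto simp: low_defect_def)
  obtain u v where x: "x = u @ False # v" "y = u @ True # v" "defect u v \<le> 1"
    using assms(1) by (auto simp: low_defect_def)
  have "u' = rev v \<and> v' = rev u"
    using rev(1,2) by (intro raised_position_unique) (simp_all add: x(1,2))
  then have "(length u + 1) div 2 + (length v + 1) div 2 \<le> 2"
    using defect_plus_defect_rev[of u v] x(3) rev(3) by simp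
  moreover have "length u + length v + 1 = length x"
    by (simp add: x(1))
  ultimately show False
    using assms(2,3) by presburger
qed

lemma balance_dyck [simp]: "balance (dyck F) = 0"
  by (induction F rule: dyck.induct) simp_all

lemma balance_prefix_dyck: "prefix p (dyck F) \<Longrightarrow> balance p \<ge> 0"
proof (induction F arbitrary: p rule: dyck.induct)
  case (2 E F)
  then show ?case
    by (fastforce simp: prefix_Cons prefix_append)
qed simp

lemma balance_suffix_dyck:
  assumes "suffix s (dyck F)"
  shows "balance s \<le> 0"
proof -
  obtain p where p: "dyck F = p @ s"
    using assms by (auto simp: suffix_def)
  then have "balance p \<ge> 0"
    by (intro balance_prefix_dyck[of _ F]) simp
  then show ?thesis
    using arg_cong[OF p, of balance] by simp
qed

text \<open>
  Strictness here, and for descents below, is what leaves a single exceptional piece in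
  \<open>positive_suffix_open_arch\<close> and \<open>negative_prefix_closing_arch\<close>: whatever is added to that
  piece makes up for its surplus of a single letter.
\<close>

lemma balance_prefix_ascent: "prefix p (ascent R) \<Longrightarrow> p \<noteq> [] \<Longrightarrow> balance p > 0"
proof (induction R arbitrary: p)
  case (Cons B R)
  then obtain q where p: "p = True # q" and "prefix q (dyck B @ ascent R)"
    by (auto simp: prefix_Cons)
  then consider "prefix q (dyck B)" | r where "q = dyck B @ r" "prefix r (ascent R)"
    by (auto simp: prefix_append)
  then show ?case
  proof cases
    case 1
    then show ?thesis
      using balance_prefix_dyck[of q B] by (simp add: p)
  next
    case 2
    then show ?thesis
      using Cons.IH[of r] by (cases "r = []") (simp_all add: p)
  qed
qed simp

lemma balance_suffix_descent: "suffix s (descent L) \<Longrightarrow> s \<noteq> [] \<Longrightarrow> balance s < 0"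
proof (induction L arbitrary: s)
  case (Cons A L)
  then obtain q where s: "s = q @ [False]" and "suffix q (descent L @ dyck A)"
    by (auto simp: suffix_snoc simp flip: append_assoc)
  then consider "suffix q (dyck A)" | r where "q = r @ dyck A" "suffix r (descent L)"
    by (auto simp: suffix_append)
  then show ?case
  proof cases
    case 1
    then show ?thesis
      using balance_suffix_dyck[of q A] by (simp add: s)
  next
    case 2
    then show ?thesis
      using Cons.IH[of r] by (cases "r = []") (simp_all add: s)
  qed
qed simp

lemma no_positive_suffix: "suffix s (descent L @ dyck A) \<Longrightarrow> balance s \<le> 0"
  using balance_suffix_dyck balance_suffix_descent
  by (fastforce simp: suffix_append)

lemma no_negative_prefix: "prefix p (dyck B @ ascent R) \<Longrightarrow> balance p \<ge> 0"
  using balance_prefix_dyck balance_prefix_ascent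
  by (fastforce simp: prefix_append)

lemma defect_leI:
  assumes "{s. suffix s u \<and> balance s > 0} \<subseteq> S" and "{p. prefix p v \<and> balance p < 0} \<subseteq> P"
    and "finite S" and "finite P" and "card S + card P \<le> d"
  shows "defect u v \<le> d"
proof -
  have "defect u v \<le> card S + card P"
    unfolding defect_def by (intro add_mono card_mono assms)
  then show ?thesis
    using assms(5) by linarith
qed

lemma low_defect_up0:
  assumes "up0 s = Some t"
  shows "low_defect (spell s) (spell t)"
  using assms
proof (cases s rule: up0.cases)
  case (2 A L M R)
  have "defect (descent L @ dyck A) (dyck M @ ascent R) \<le> 1"
    by (rule defect_leI[where S = "{}" and P = "{}"])
      (use no_positive_suffix no_negative_prefix in \<open>fastforce+\<close>)
  moreover have "spell s = (descent L @ dyck A) @ False # (dyck M @ ascent R)"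
    "spell t = (descent L @ dyck A) @ True # (dyck M @ ascent R)"
    using assms 2 by auto
  ultimately show ?thesis
    unfolding low_defect_def by blast
qed simp

lemma positive_suffix_open_arch:
  assumes "suffix s (descent L @ True # dyck E)" and "balance s > 0"
  shows "s = True # dyck E"
proof -
  consider "suffix s (dyck E)" | r where "s = r @ True # dyck E" "suffix r (descent L)"
    using assms(1) by (auto simp: suffix_append suffix_Cons)
  then show ?thesis
  proof cases
    case 1
    then show ?thesis
      using balance_suffix_dyck assms(2) by fastforce
  next
    case 2
    then show ?thesis
      using balance_suffix_descent[of r L] assms(2) by (cases "r = []") simp_all
  qed
qed

lemma negative_prefix_closing_arch:
  assumes "prefix p (dyck A @ False # ascent R)" and "balance p < 0"
  shows "p = dyck A @ [False]"
proof -
  consider "prefix p (dyck A)" | r where "p = dyck A @ False # r" "prefix r (ascent R)"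
    using assms(1) by (auto simp: prefix_append prefix_Cons)
  then show ?thesis
  proof cases
    case 1
    then show ?thesis
      using balance_prefix_dyck assms(2) by fastforce
  next
    case 2
    then show ?thesis
      using balance_prefix_ascent[of r R] assms(2) by (cases "r = []") simp_all
  qed
qed

lemma low_defect_up1:
  assumes "up1 s = Some t"
  shows "low_defect (spell s) (spell t)"
  using assms
proof (cases s rule: up1.cases)
  case (1 L E F R)
  have "defect (descent L @ True # dyck E) (dyck F @ ascent R) \<le> 1"
    by (rule defect_leI[where S = "{True # dyck E}" and P = "{}"])
      (use positive_suffix_open_arch no_negative_prefix in \<open>fastforce+\<close>)
  moreover have "spell s = (descent L @ True # dyck E) @ False # (dyck F @ ascent R)"
    "spell t = (descent L @ True # dyck E) @ True # (dyck F @ ascent R)"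
    using assms 1 by auto
  ultimately show ?thesis
    unfolding low_defect_def by blast
next
  case (2 A A' L R)
  have "defect (descent L @ dyck A') (dyck A @ False # ascent R) \<le> 1"
    by (rule defect_leI[where S = "{}" and P = "{dyck A @ [False]}"])
      (use no_positive_suffix negative_prefix_closing_arch in \<open>fastforce+\<close>)
  moreover have "spell s = (descent L @ dyck A') @ False # (dyck A @ False # ascent R)"
    "spell t = (descent L @ dyck A') @ True # (dyck A @ False # ascent R)"
    using assms 2 by auto
  ultimately show ?thesis
    unfolding low_defect_def by blast
qed simp_all

text \<open>
  The map \<open>up0\<close> uses up one unmatched zero, whereas \<open>up1\<close> uses up none or two.
\<close>

lemma up0_neq_up1:
  assumes "up0 s = Some t"
  shows "up1 s \<noteq> Some t"
proof
  assume up1: "up1 s = Some t"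
  from assms obtain A L M R where "s = (A # L, M, R)" "t = (L, A, M # R)"
    by (cases s rule: up0.cases) auto
  with up1 show False
    by (cases M rule: forest_cases; cases L) simp_all
qed

section \<open>Four pairwise edge-disjoint decompositions\<close>

text \<open>
  This makes edge-disjoint decompositions distinct, so that a set of four of them has four elements.
  The witness is the chain through the all-zero word, which has to climb through all levels.
\<close>

lemma is_SCD_not_edge_disjoint_self:
  assumes "is_SCD n C" and "n > 0"
  shows "\<not> edge_disjoint C C"
proof -
  have "replicate n False \<in> \<Union> (set ` C)"
    using assms(1) by (simp add: is_SCD_def partition_on_def cube_def)
  then obtain p where p: "p \<in> C" "replicate n False \<in> set p"
    by blast
  then obtain k where k: "2 * k \<le> n" "length p = n - 2 * k + 1"
      "\<And>i. k \<le> i \<Longrightarrow> i \<le> n - k \<Longrightarrow> p ! (i - k) \<in> level n i"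
    using assms(1) by (auto simp: is_SCD_def symmetric_chain_def)
  obtain j where j: "j < length p" "p ! j = replicate n False"
    using p(2) by (auto simp: in_set_conv_nth)
  then have "replicate n False \<in> level n (j + k)"
    using k(3)[of "j + k"] k(1,2) by simp
  then have "k = 0"
    by (simp add: level_def count_list_0_iff)
  then obtain x y p' where "p = x # y # p'"
    using k(2) \<open>n > 0\<close> by (cases p rule: vwalk_arcs.cases) auto
  then have "{x, y} \<in> path_edges p"
    by (auto simp: path_edges_def)
  then show ?thesis
    using p(1) by (auto simp: edge_disjoint_def)
qed

text \<open>
  A path edge is an unordered pair; the condition \<open>raises x y\<close> tells its lower end from its upper end.
\<close>

definition uses_edges :: "nat \<Rightarrow> bool list list set \<Rightarrow> (bool list \<Rightarrow> bool list \<Rightarrow> bool) \<Rightarrow> bool" where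
  "uses_edges n C E \<longleftrightarrow> (\<forall>p\<in>C. \<forall>e\<in>path_edges p. \<exists>x y. E x y \<and> raises x y \<and> length x = n \<and> e = {x, y})"

lemma (in chain_map) SCD_with_edges:
  "\<exists>C. is_SCD n C \<and> uses_edges n C (\<lambda>x y. \<exists>s t. up s = Some t \<and> x = spell s \<and> y = spell t)"
proof (intro exI conjI)
  show "is_SCD n (chain ` bottoms)"
    by (rule is_SCD_chains)
  show "uses_edges n (chain ` bottoms) (\<lambda>x y. \<exists>s t. up s = Some t \<and> x = spell s \<and> y = spell t)"
    unfolding uses_edges_def using path_edges_chain raises_up by blast
qed

lemma edge_disjointI:
  assumes C: "uses_edges n C E" and D: "uses_edges n D E'"
    and disjoint: "\<And>x y. E x y \<Longrightarrow> E' x y \<Longrightarrow> length x = n \<Longrightarrow> False"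
  shows "edge_disjoint C D"
  unfolding edge_disjoint_def
proof (intro ballI, rule ccontr)
  fix p q assume p: "p \<in> C" and q: "q \<in> D" and "path_edges p \<inter> path_edges q \<noteq> {}"
  then obtain e where "e \<in> path_edges p" "e \<in> path_edges q"
    by blast
  then obtain x y x' y' where
    1: "E x y" "raises x y" "length x = n" "e = {x, y}" and
    2: "E' x' y'" "raises x' y'" "e = {x', y'}"
    using C D p q unfolding uses_edges_def by meson
  have "ones y = Suc (ones x)" "ones y' = Suc (ones x')"
    using 1(2) 2(2) by (simp_all add: raises_ones)
  then have "x = x' \<and> y = y'"
    using 1(4) 2(3) by (auto simp: doubleton_eq_iff)
  then show False
    using disjoint 1 2 by blast
qed

lemma edge_disjoint_sym: "edge_disjoint C D \<Longrightarrow> edge_disjoint D C"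
  by (auto simp: edge_disjoint_def)

theorem theorem3:
  fixes n :: nat
  assumes "even n" and "n \<ge> 6"
  shows "\<exists>S :: bool list list set set.
           card S = 4 \<and> (\<forall>C\<in>S. is_SCD n C) \<and> pairwise edge_disjoint S"
proof -
  define edges where
    "edges sp up = (\<lambda>x y. \<exists>s t. up s = Some t \<and> x = sp s \<and> y = sp t)"
    for sp :: "zipper \<Rightarrow> bool list" and up :: "zipper \<Rightarrow> zipper option"
  note maps = chain_map_up0[of n] chain_map_up1[OF assms(1)]
  obtain C0 where C0: "is_SCD n C0" "uses_edges n C0 (edges spell up0)"
    unfolding edges_def using chain_map.SCD_with_edges[OF maps(1)] by blast
  obtain C1 where C1: "is_SCD n C1" "uses_edges n C1 (edges spell up1)"
    unfolding edges_def using chain_map.SCD_with_edges[OF maps(2)] by blast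
  obtain D0 where D0: "is_SCD n D0" "uses_edges n D0 (edges (rev \<circ> spell) up0)"
    unfolding edges_def using chain_map.SCD_with_edges[OF chain_map_rev[OF maps(1)]] by blast
  obtain D1 where D1: "is_SCD n D1" "uses_edges n D1 (edges (rev \<circ> spell) up1)"
    unfolding edges_def using chain_map.SCD_with_edges[OF chain_map_rev[OF maps(2)]] by blast
  have same: False if "edges sp up0 x y" "edges sp up1 x y" "inj sp" for sp x y
    using that up0_neq_up1 unfolding edges_def by (metis injD)
  have "inj spell" and "inj (rev \<circ> spell)"
    using bij_spell by (simp_all add: bij_is_inj inj_compose)
  note same = same[OF _ _ this(1)] same[OF _ _ this(2)]
  have near: "low_defect x y" if "edges spell up x y" "up \<in> {up0, up1}" for x y up
    using that low_defect_up0 low_defect_up1 by (auto simp: edges_def)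
  have near_rev: "low_defect (rev x) (rev y)"
    if "edges (rev \<circ> spell) up x y" "up \<in> {up0, up1}" for x y up
    using that low_defect_up0 low_defect_up1 by (auto simp: edges_def)
  have opposite: False
    if "edges spell up x y" "edges (rev \<circ> spell) up' x y" "length x = n"
      "up \<in> {up0, up1}" "up' \<in> {up0, up1}" for up up' x y
    using no_low_defect_rev[OF near[OF that(1,4)]] near_rev[OF that(2,5)] that(3) assms
    by blast
  have disjoint: "edge_disjoint C0 C1" "edge_disjoint D0 D1"
    "edge_disjoint C0 D0" "edge_disjoint C0 D1" "edge_disjoint C1 D0" "edge_disjoint C1 D1"
    using same opposite
    by (blast intro: edge_disjointI[OF C0(2) C1(2)] edge_disjointI[OF D0(2) D1(2)]
        edge_disjointI[OF C0(2) D0(2)] edge_disjointI[OF C0(2) D1(2)]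
        edge_disjointI[OF C1(2) D0(2)] edge_disjointI[OF C1(2) D1(2)])+
  have "n > 0"
    using assms(2) by simp
  note self = is_SCD_not_edge_disjoint_self[OF _ this]
  have "distinct [C0, C1, D0, D1]"
    using self[OF C0(1)] self[OF C1(1)] self[OF D0(1)] disjoint by auto
  then have "card {C0, C1, D0, D1} = 4"
    using distinct_card[of "[C0, C1, D0, D1]"] by simp
  moreover have "pairwise edge_disjoint {C0, C1, D0, D1}"
    using disjoint edge_disjoint_sym by (auto simp: pairwise_def)
  ultimately show ?thesis
    using C0(1) C1(1) D0(1) D1(1) by (intro exI[of _ "{C0, C1, D0, D1}"]) simp
qed

end
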